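(* Fix $1<p<\infty$. Let $k\ge1$ and let $d_0,\dots,d_{k-1}\ge1$ be integers with $d_0\ge2$. Let $G$ be the spherically symmetric tree with layers $0,1,\dots,k$, in which layer $0$ consists of a single root $o$ and every vertex in layer $i$ has exactly $d_i$ children (in layer $i+1$) for $0\le i<k$. Then $o$ minimizes $T_G(r)$ over all $r\in V$. If $$S=\sum_{1\le i\le j\le k-1}(d_id_{i+1}\cdots d_j)^{1/(p-1)},$$ where the sum is empty for $k=1$, then $$1+S\ \le\ T_G\ \le\ 1+2S.$$ The maximum graph degree of $G$ is $$\Delta_G=\max\Bigl\{d_0,\ 1+\max_{1\le i<k}d_i\Bigr\},$$ with the second maximum omitted for $k=1$.
   Context: Tree parameter (for a finite tree $G=(V,E)$ with at least two vertices): root the tree at $r\in V$. Define weights recursively: $w_r(v)=1$ if $v$ has no children, and otherwise $$w_r(v)=\Bigl(\sum_{z\text{ child of }v}(w_r(z)+1)^{p-1}\Bigr)^{1/(p-1)}.$$ With $\operatorname{Path}(x,r)$ the vertex set of the unique path from $x$ to $r$, let $$T_G(r)=\max_{x\in V}\sum_{v\in\operatorname{Path}(x,r),\,v\ne r}w_r(v),\qquad T_G=\min_{r\in V}T_G(r).$$ The dependence of $w_r$ and $T_G$ on $p$ is suppressed. *)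

theory Defs
  imports "HOL-Analysis.Analysis" "Graph_Theory.Graph_Theory"
begin

(* Finite simple undirected graphs are the library's pair graphs: finite, loop-free, symmetric
   arc relation.  The library's predicate "tree" is meant for oriented graphs: it counts the pair
   of opposite arcs of an edge as a cycle, so no pair graph with an edge satisfies it.  Hence
   cycles are required to have length at least 3 here. *)
definition finite_tree :: "'a pair_pre_digraph \<Rightarrow> bool" where
  "finite_tree G \<longleftrightarrow> pair_graph G \<and> connected (with_proj G) \<and>
     \<not> (\<exists>c. pre_digraph.cycle (with_proj G) c \<and> 3 \<le> length c)"

definition tree_path :: "'a pair_pre_digraph \<Rightarrow> 'a \<Rightarrow> 'a \<Rightarrow> ('a \<times> 'a) list" where
  "tree_path G x r = (THE q. pre_digraph.apath (with_proj G) x q r)"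

lemma finite_tree_apath_unique:
  assumes "finite_tree G" "pre_digraph.apath (with_proj G) u p v"
    "pre_digraph.apath (with_proj G) u q v"
  shows "p = q"
proof -
  interpret pair_graph G using assms(1) by (simp add: finite_tree_def)
  show ?thesis using assms(2,3)
  proof (induction p arbitrary: u q)
    case Nil
    then show ?case using apath_nonempty_ends[of v q v] by (auto simp: apath_simps)
  next
    case (Cons e p')
    from Cons.prems have "u \<noteq> v" using apath_nonempty_ends[of u "e # p'" v] by simp
    with Cons.prems(2) obtain f q' where q: "q = f # q'"
      by (cases q) (auto simp: apath_simps)
    obtain a where e: "e = (u, a)" using Cons.prems(1) by (cases e) (auto simp: apath_simps)
    obtain b where f: "f = (u, b)" using Cons.prems(2) q by (cases f) (auto simp: apath_simps)
    have P: "(u, a) \<in> parcs G" "apath a p' v" "u \<notin> set (awalk_verts a p')"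
      using Cons.prems(1) e by (auto simp: apath_simps)
    have Q: "(u, b) \<in> parcs G" "apath b q' v" "u \<notin> set (awalk_verts b q')"
      using Cons.prems(2) q f by (auto simp: apath_simps)
    show ?case
    proof (cases "a = b")
      case True
      with Cons.IH P(2) Q(2) e f q show ?thesis by auto
    next
      case False
      have "awalk a p' v" "awalk b q' v" using P(2) Q(2) by (auto simp: apath_def)
      then have "\<exists>x\<in>set (awalk_verts a p'). x \<in> set (awalk_verts b q')"
        by (intro bexI[of _ v]) auto
      then obtain xs x ys where xs: "awalk_verts a p' = xs @ x # ys"
        "x \<in> set (awalk_verts b q')" "\<forall>y\<in>set xs. y \<notin> set (awalk_verts b q')"
        using split_list_first_prop[of "awalk_verts a p'" "\<lambda>x. x \<in> set (awalk_verts b q')"] by blast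
      obtain xs' ys' where ys': "awalk_verts b q' = xs' @ x # ys'"
        using xs(2) by (meson split_list)
      obtain p1 p2 where p1: "cas a p1 x" "p' = p1 @ p2" "awalk_verts a p1 = xs @ [x]"
        using awalk_decomp_verts[OF _ xs(1), of v] \<open>awalk a p' v\<close> by blast
      obtain q1 q2 where q1: "cas b q1 x" "q' = q1 @ q2" "awalk_verts b q1 = xs' @ [x]"
        using awalk_decomp_verts[OF _ ys', of v] \<open>awalk b q' v\<close> by blast
      have wp: "awalk a p1 x" using \<open>awalk a p' v\<close> p1 by (auto simp: awalk_def)
      have wq: "awalk b q1 x" using \<open>awalk b q' v\<close> q1 by (auto simp: awalk_def)
      define c where "c = (u, a) # p1 @ rev_path q1 @ [(b, u)]"
      have bu: "(b, u) \<in> parcs G" using Q(1) pair_sym_arcs arcs_symmetric by auto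
      have w: "awalk u c u" unfolding c_def
        using P(1) wp wq bu by (auto simp: awalk_simps dest: in_arcsD1 in_arcsD2)
      have w1: "awalk a (p1 @ rev_path q1 @ [(b, u)]) u"
        using w by (auto simp: c_def awalk_simps)
      have w2: "awalk x (rev_path q1 @ [(b, u)]) u"
        using wq bu by (auto simp: awalk_simps dest: in_arcsD1 in_arcsD2)
      have wr: "awalk x (rev_path q1) b" using wq by simp
      have vr: "awalk_verts x (rev_path q1) = x # rev xs'"
        using awalk_verts_rev_path[OF wq] q1(3) by simp
      have v2: "awalk_verts x (rev_path q1 @ [(b, u)]) = x # rev xs' @ [u]"
        using awalk_verts_append[OF w2] vr wr by simp
      have "awalk_verts a (p1 @ rev_path q1 @ [(b, u)]) = (xs @ [x]) @ rev xs' @ [u]"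
        using awalk_verts_append[OF w1] v2 wp p1(3) by simp
      then have tlv: "tl (awalk_verts u c) = (xs @ [x]) @ rev xs' @ [u]"
        by (simp add: c_def)
      have "distinct (xs @ [x])" "distinct (xs' @ [x])" "u \<notin> set (xs @ [x])" "u \<notin> set (xs' @ [x])"
        "set xs \<inter> set xs' = {}"
        using P(2,3) Q(2,3) xs ys' by (auto simp: apath_def)
      then have "distinct (tl (awalk_verts u c))" unfolding tlv by auto
      moreover have "3 \<le> length c"
      proof -
        have "\<not> (p1 = [] \<and> q1 = [])" using False p1(1) q1(1) by auto
        then show ?thesis by (cases p1; cases q1) (auto simp: c_def)
      qed
      moreover have "c \<noteq> []" by (simp add: c_def)
      ultimately have "cycle c \<and> 3 \<le> length c" using w unfolding cycle_def by auto
      then show ?thesis using assms(1) unfolding finite_tree_def by blast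
    qed
  qed
qed

lemma tree_path_eq:
  assumes "finite_tree G" "pre_digraph.apath (with_proj G) x q r"
  shows "tree_path G x r = q"
  unfolding tree_path_def
  by (rule the_equality, rule assms(2)) (rule finite_tree_apath_unique[OF assms(1) _ assms(2)])

lemma finite_tree_apath_tree_path:
  assumes "finite_tree G" "x \<in> pverts G" "r \<in> pverts G"
  shows "pre_digraph.apath (with_proj G) x (tree_path G x r) r"
proof -
  interpret pair_graph G using assms(1) by (simp add: finite_tree_def)
  have "x \<rightarrow>\<^sup>*\<^bsub>with_proj (mk_symmetric (with_proj G))\<^esub> r"
    using assms by (auto simp: finite_tree_def connected_def strongly_connected_def)
  then have "x \<rightarrow>\<^sup>*\<^bsub>with_proj G\<^esub> r"
    using reachable_mk_symmetric_eq[OF sym_arcs] by blast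
  then obtain q where "apath x q r" using reachable_apath by blast
  with tree_path_eq[OF assms(1)] show ?thesis by metis
qed

definition path_verts :: "'a pair_pre_digraph \<Rightarrow> 'a \<Rightarrow> 'a \<Rightarrow> 'a set" where
  "path_verts G x r = set (pawalk_verts x (tree_path G x r))"

definition children :: "'a pair_pre_digraph \<Rightarrow> 'a \<Rightarrow> 'a \<Rightarrow> 'a set" where
  "children G r v = {z. (v, z) \<in> parcs G \<and> v \<in> path_verts G z r}"

lemma path_verts_child:
  assumes "finite_tree G" "r \<in> pverts G" "z \<in> children G r v"
  shows "path_verts G v r \<subset> path_verts G z r"
proof -
  interpret pair_graph G using assms(1) by (simp add: finite_tree_def)
  have vz: "(v, z) \<in> parcs G" "v \<in> path_verts G z r" using assms(3) by (auto simp: children_def)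
  let ?p = "tree_path G z r"
  have p: "apath z ?p r"
    using finite_tree_apath_tree_path[OF assms(1)] assms(2) vz(1) in_arcsD2 by blast
  then have w: "awalk z ?p r" by (simp add: apath_def)
  obtain q s where qs: "?p = q @ s" "awalk z q v" "awalk v s r"
    using awalk_decomp[OF w, of v] vz(2) by (auto simp: path_verts_def)
  have "awlast z q = v" using qs(2) by auto
  with p qs(1) have s: "apath v s r" and "set (awalk_verts z q) \<inter> set (tl (awalk_verts v s)) = {}"
    by (auto simp: apath_append_iff)
  moreover have "z \<noteq> v" using no_loops'[OF vz(1)] by auto
  moreover have "z \<in> set (awalk_verts z q)" using qs(2) hd_in_awalk_verts by blast
  ultimately have "z \<notin> set (awalk_verts v s)"
    using qs(3) by (cases s) (auto simp: awalk_simps)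
  moreover have "z \<in> set (awalk_verts z ?p)" using w hd_in_awalk_verts by blast
  moreover have "set (awalk_verts v s) \<subseteq> set (awalk_verts z ?p)"
    using set_awalk_verts_append[OF qs(2,3)] qs(1) by auto
  ultimately show ?thesis
    using tree_path_eq[OF assms(1) s] by (auto simp: path_verts_def)
qed

lemma wf_children:
  assumes "finite_tree G" "r \<in> pverts G"
  shows "wf {(z, v). z \<in> children G r v}"
proof -
  interpret pair_graph G using assms(1) by (simp add: finite_tree_def)
  have "{(z, v). z \<in> children G r v} \<subseteq> (parcs G)\<inverse>" by (auto simp: children_def)
  then have "finite {(z, v). z \<in> children G r v}"
    by (rule finite_subset) (simp add: pair_finite_arcs)
  moreover have "acyclic {(z, v). z \<in> children G r v}"
  proof (rule acyclicI, intro allI notI)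
    fix x assume "(x, x) \<in> {(z, v). z \<in> children G r v}\<^sup>+"
    moreover have "path_verts G v r \<subset> path_verts G z r"
      if "(z, v) \<in> {(z, v). z \<in> children G r v}\<^sup>+" for z v
      using that by (induction rule: trancl_induct) (use path_verts_child[OF assms] in blast)+
    ultimately show False by blast
  qed
  ultimately show ?thesis by (rule finite_acyclic_wf)
qed

(* Recursion along the child relation; weight_rec below is the resulting equation. *)
definition weight :: "real \<Rightarrow> 'a pair_pre_digraph \<Rightarrow> 'a \<Rightarrow> 'a \<Rightarrow> real" where
  "weight p G r = wfrec {(z, v). z \<in> children G r v}
     (\<lambda>w v. if children G r v = {} then 1
             else (\<Sum>z\<in>children G r v. (w z + 1) powr (p - 1)) powr (1 / (p - 1)))"

lemma weight_rec:
  assumes "finite_tree G" "r \<in> pverts G"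
  shows "weight p G r v = (if children G r v = {} then 1
    else (\<Sum>z\<in>children G r v. (weight p G r z + 1) powr (p - 1)) powr (1 / (p - 1)))"
  unfolding weight_def
  by (subst wfrec[OF wf_children[OF assms]]) (auto simp: cut_def intro!: arg_cong[where f="\<lambda>x. x powr _"] sum.cong)

definition tree_param_at :: "real \<Rightarrow> 'a pair_pre_digraph \<Rightarrow> 'a \<Rightarrow> real" where
  "tree_param_at p G r =
     Max ((\<lambda>x. \<Sum>v\<in>path_verts G x r - {r}. weight p G r v) ` pverts G)"

definition tree_param :: "real \<Rightarrow> 'a pair_pre_digraph \<Rightarrow> real" where
  "tree_param p G = Min (tree_param_at p G ` pverts G)"

definition layer :: "'a pair_pre_digraph \<Rightarrow> 'a \<Rightarrow> nat \<Rightarrow> 'a set" where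
  "layer G r i = {v \<in> pverts G. length (tree_path G v r) = i}"

definition spherically_symmetric_tree ::
    "'a pair_pre_digraph \<Rightarrow> 'a \<Rightarrow> nat \<Rightarrow> (nat \<Rightarrow> nat) \<Rightarrow> bool" where
  "spherically_symmetric_tree G r k d \<longleftrightarrow>
     finite_tree G \<and> r \<in> pverts G \<and> pverts G = (\<Union>i\<in>{0..k}. layer G r i) \<and>
     (\<forall>i<k. \<forall>v\<in>layer G r i. card (children G r v) = d i)"

(* Both arcs of an edge are present, so the out-degree is the undirected degree. *)
definition max_degree :: "'a pair_pre_digraph \<Rightarrow> nat" where
  "max_degree G = Max (out_degree (with_proj G) ` pverts G)"

end

theory Submission
  imports Defs
begin

text \<open>
  Rooted at \<open>o\<close>, a spherically symmetric tree has weights that depend only on the layer. Since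
  \<open>(d * (a + 1) ^ (p - 1)) ^ (1 / (p - 1)) = d ^ (1 / (p - 1)) * (a + 1)\<close>, the weights \<open>a\<^sub>i\<close> satisfy
  the affine recursion \<open>a\<^sub>k = 1\<close>, \<open>a\<^sub>i = d\<^sub>i ^ (1 / (p - 1)) * (a\<^sub>i\<^sub>+\<^sub>1 + 1)\<close>. Unrolling it gives
  \<open>a\<^sub>i = (\<Sum>j=i..k-1. (d\<^sub>i \<cdots> d\<^sub>j) ^ (1 / (p - 1))) + (d\<^sub>i \<cdots> d\<^sub>k\<^sub>-\<^sub>1) ^ (1 / (p - 1))\<close>
  (\<open>layer_weight\<close>). A path from a leaf to \<open>o\<close> collects \<open>a\<^sub>1 + \<cdots> + a\<^sub>k = 1 + S + R\<close>, where \<open>R\<close>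
  consists of the terms of \<open>S\<close> with \<open>j = k - 1\<close>. Hence \<open>0 \<le> R \<le> S\<close>, and the parameter at \<open>o\<close> lies
  between \<open>1 + S\<close> and \<open>1 + 2 * S\<close>.

  It remains to see that no other root \<open>r\<close> does better. Moving the root from \<open>o\<close> to \<open>r\<close> reverses the
  parent relation only along the path between them: a vertex off this path keeps its set of
  children, its descendants are off the path too, and so it keeps its weight (\<open>weight_reroot\<close>).
  As \<open>o\<close> has at least two children, one of them, \<open>c\<close>, is not on the path from \<open>r\<close> to \<open>o\<close>. The path
  from a leaf below \<open>c\<close> to \<open>r\<close> has to leave the branch of \<open>c\<close> through the same vertices as the path to
  \<open>o\<close>. It therefore collects at least \<open>a\<^sub>1 + \<cdots> + a\<^sub>k\<close>, which is the parameter at \<open>o\<close>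
  (\<open>tree_param_at_root_le\<close>).

  The degree of a vertex is its number of children, plus one for the parent if it is not the root.
\<close>

section \<open>Rooted trees: parents, children and paths\<close>

locale finite_tree_graph = pair_graph G for G :: "'a pair_pre_digraph" +
  assumes tree: "finite_tree G"
begin

lemma children_arc: "z \<in> children G r v \<Longrightarrow> (v, z) \<in> parcs G"
  by (simp add: children_def)

lemma children_verts:
  assumes "z \<in> children G r v"
  shows "v \<in> pverts G" "z \<in> pverts G"
  using children_arc[OF assms] in_arcsD1 in_arcsD2 by auto

lemma finite_children: "finite (children G r v)"
  using children_verts(2) by (intro finite_subset[OF _ pair_finite_verts]) auto

lemma self_in_path_verts:
  assumes "x \<in> pverts G" "r \<in> pverts G"
  shows "x \<in> path_verts G x r"
  using finite_tree_apath_tree_path[OF tree assms] hd_in_awalk_verts(1)[of x "tree_path G x r" r]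
  by (auto simp: path_verts_def apath_def)

lemma tree_path_self: "r \<in> pverts G \<Longrightarrow> tree_path G r r = []"
  by (rule tree_path_eq[OF tree]) (simp add: apath_Nil_iff)

lemma path_verts_self: "r \<in> pverts G \<Longrightarrow> path_verts G r r = {r}"
  by (simp add: path_verts_def tree_path_self)

text \<open>
  If \<open>v\<close> is not on the path from its neighbour \<open>z\<close> to the root, then prefixing that path with the
  arc from \<open>v\<close> to \<open>z\<close> yields a path from \<open>v\<close>; by uniqueness it is the path from \<open>v\<close>, and it visits \<open>z\<close>.
\<close>
lemma child_or_parent:
  assumes "r \<in> pverts G" "(v, z) \<in> parcs G"
  shows "z \<in> children G r v \<or> v \<in> children G r z"
proof (cases "v \<in> path_verts G z r")
  case False
  have "apath z (tree_path G z r) r"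
    using finite_tree_apath_tree_path[OF tree in_arcsD2[OF assms(2)] assms(1)] .
  with False have "apath v ((v, z) # tree_path G z r) r"
    using assms(2) by (simp add: apath_Cons_iff path_verts_def)
  then have "tree_path G v r = (v, z) # tree_path G z r"
    by (rule tree_path_eq[OF tree])
  then have "z \<in> path_verts G v r"
    using self_in_path_verts[OF in_arcsD2[OF assms(2)] assms(1)] by (simp add: path_verts_def)
  moreover have "(z, v) \<in> parcs G"
    using assms(2) by (simp add: arcs_symmetric)
  ultimately show ?thesis by (simp add: children_def)
qed (use assms in \<open>simp add: children_def\<close>)

lemma child_not_in_path_verts:
  assumes "r \<in> pverts G" "z \<in> children G r v"
  shows "z \<notin> path_verts G v r"
proof
  assume "z \<in> path_verts G v r"
  then have "v \<in> children G r z"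
    using children_arc[OF assms(2)] by (simp add: children_def arcs_symmetric)
  then show False
    using path_verts_child[OF tree assms] path_verts_child[OF tree assms(1)] by blast
qed

text \<open>
  The child does not lie on the path of its parent, so prefixing the arc to the parent keeps the
  walk free of repetitions. Uniqueness of parents, and every induction from the root outwards,
  rests on this equation.
\<close>
lemma tree_path_child:
  assumes "r \<in> pverts G" "z \<in> children G r v"
  shows "tree_path G z r = (z, v) # tree_path G v r"
proof (rule tree_path_eq[OF tree])
  have "apath v (tree_path G v r) r"
    using finite_tree_apath_tree_path[OF tree children_verts(1)[OF assms(2)] assms(1)] .
  then show "apath z ((z, v) # tree_path G v r) r"
    using children_arc[OF assms(2)] child_not_in_path_verts[OF assms]
    by (simp add: apath_Cons_iff path_verts_def arcs_symmetric)
qed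

lemma path_verts_insert_child:
  assumes "r \<in> pverts G" "z \<in> children G r v"
  shows "path_verts G z r = insert z (path_verts G v r)"
  by (simp add: path_verts_def tree_path_child[OF assms])

lemma parent_unique:
  assumes "r \<in> pverts G" "v \<in> children G r u" "v \<in> children G r u'"
  shows "u = u'"
  using tree_path_child[OF assms(1,2)] tree_path_child[OF assms(1,3)] by simp

lemma root_not_child:
  assumes "r \<in> pverts G"
  shows "r \<notin> children G r u"
  using tree_path_child[OF assms, of r u] tree_path_self[OF assms] by auto

lemma parent_exists:
  assumes "r \<in> pverts G" "v \<in> pverts G" "v \<noteq> r"
  obtains u where "v \<in> children G r u"
proof -
  have p: "apath v (tree_path G v r) r"
    using finite_tree_apath_tree_path[OF tree assms(2,1)] .
  with \<open>v \<noteq> r\<close> obtain e q where eq: "tree_path G v r = e # q"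
    by (cases "tree_path G v r") (auto simp: apath_Nil_iff)
  with p obtain u where e: "e = (v, u)" "(v, u) \<in> parcs G" "apath u q r"
    by (cases e) (auto simp: apath_Cons_iff)
  then have "u \<in> path_verts G v r"
    using eq tree_path_eq[OF tree e(3)] self_in_path_verts[OF in_arcsD2[OF e(2)] assms(1)]
    by (simp add: path_verts_def)
  then have "v \<in> children G r u"
    using e(2) by (simp add: children_def arcs_symmetric)
  then show ?thesis by (rule that)
qed

text \<open>
  The tree seen as generated from its root by passing to children: the length of the path to the
  root decreases from a vertex to its parent.
\<close>
lemma tree_induct [consumes 2, case_names root child]:
  assumes "r \<in> pverts G" "x \<in> pverts G"
    and "P r"
    and "\<And>v z. v \<in> pverts G \<Longrightarrow> z \<in> children G r v \<Longrightarrow> P v \<Longrightarrow> P z"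
  shows "P x"
  using assms(2)
proof (induction "length (tree_path G x r)" arbitrary: x rule: less_induct)
  case less
  show ?case
  proof (cases "x = r")
    case False
    then obtain u where u: "x \<in> children G r u"
      using parent_exists[OF assms(1) less.prems] by blast
    have "P u"
      using less.hyps[of u] children_verts(1)[OF u] tree_path_child[OF assms(1) u] by simp
    then show ?thesis
      using assms(4) u children_verts(1)[OF u] by blast
  qed (use assms(3) in simp)
qed

lemma neighbours_root:
  assumes "r \<in> pverts G"
  shows "{z. (r, z) \<in> parcs G} = children G r r"
  using child_or_parent[OF assms] root_not_child[OF assms] children_arc by blast

text \<open>
  Both the degree count and the comparison of two roots use this splitting: the set of neighbours
  does not depend on the root, only the choice of the parent in it does.
\<close>
lemma neighbours_nonroot:
  assumes "r \<in> pverts G" "v \<in> children G r u"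
  shows "{z. (v, z) \<in> parcs G} = insert u (children G r v)" "u \<notin> children G r v"
proof -
  have "(v, u) \<in> parcs G"
    using children_arc[OF assms(2)] by (simp add: arcs_symmetric)
  then show "{z. (v, z) \<in> parcs G} = insert u (children G r v)"
    using child_or_parent[OF assms(1)] parent_unique[OF assms] children_arc by blast
  show "u \<notin> children G r v"
    using path_verts_child[OF tree assms] path_verts_child[OF tree assms(1), of u v] by blast
qed

lemma out_degree_neighbours: "out_degree (with_proj G) v = card {z. (v, z) \<in> parcs G}"
proof -
  have "out_arcs (with_proj G) v = Pair v ` {z. (v, z) \<in> parcs G}"
    by (auto simp: out_arcs_def)
  then show ?thesis
    by (simp add: out_degree_def card_image inj_on_def)
qed

lemma root_in_path_verts:
  assumes "r \<in> pverts G" "x \<in> pverts G"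
  shows "r \<in> path_verts G x r"
  using assms
proof (induction rule: tree_induct)
  case root
  then show ?case using assms by (simp add: path_verts_self)
qed (simp add: path_verts_insert_child[OF assms(1)])

lemma path_verts_subset:
  assumes "r \<in> pverts G" "x \<in> pverts G" "v \<in> path_verts G x r"
  shows "path_verts G v r \<subseteq> path_verts G x r"
  using assms
proof (induction rule: tree_induct)
  case root
  then show ?case using assms by (simp add: path_verts_self)
next
  case (child u z)
  then show ?case by (auto simp: path_verts_insert_child[OF assms(1) child(2)])
qed

lemma path_verts_in_verts:
  assumes "r \<in> pverts G" "x \<in> pverts G"
  shows "path_verts G x r \<subseteq> pverts G"
  using assms
proof (induction rule: tree_induct)
  case root
  then show ?case using assms by (simp add: path_verts_self)
next
  case (child u z)
  then show ?case
    using children_verts[OF child(2)] by (simp add: path_verts_insert_child[OF assms(1)])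
qed

lemma finite_path_verts: "finite (path_verts G x r)"
  by (simp add: path_verts_def)

lemma path_length_le:
  assumes "r \<in> pverts G" "x \<in> pverts G" "v \<in> path_verts G x r"
  shows "length (tree_path G v r) \<le> length (tree_path G x r)"
  using assms
proof (induction rule: tree_induct)
  case root
  then show ?case using assms by (simp add: path_verts_self)
next
  case (child u z)
  then show ?case
    using tree_path_child[OF assms(1) child(2)]
    by (auto simp: path_verts_insert_child[OF assms(1) child(2)])
qed

text \<open>
  Along a path to the root the distance to the root strictly decreases.
\<close>
lemma path_vertex_unique_at_depth:
  assumes "r \<in> pverts G" "x \<in> pverts G" "a \<in> path_verts G x r" "b \<in> path_verts G x r"
    and "length (tree_path G a r) = length (tree_path G b r)"
  shows "a = b"
  using assms
proof (induction rule: tree_induct)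
  case root
  then show ?case using assms by (simp add: path_verts_self)
next
  case (child u z)
  have shorter: "length (tree_path G w r) < length (tree_path G z r)"
    if "w \<in> path_verts G u r" for w
    using path_length_le[OF assms(1) child(1) that] tree_path_child[OF assms(1) child(2)] by simp
  from child show ?case
    by (auto simp: path_verts_insert_child[OF assms(1) child(2)] dest: shorter)
qed

section \<open>Moving the root\<close>

text \<open>
  The vertices \<open>x\<close> with \<open>v \<in> path_verts G x s\<close> form the subtree below \<open>v\<close>, and the only arc that leaves
  it goes from \<open>v\<close> to the parent of \<open>v\<close>.
\<close>
lemma walk_leaving_subtree:
  assumes "s \<in> pverts G" "awalk x q r" "v \<in> path_verts G x s" "v \<notin> path_verts G r s"
  shows "v \<in> set (pawalk_verts x q)"
  using assms(2,3)
proof (induction q arbitrary: x)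
  case Nil
  then show ?case using assms(4) by (simp add: awalk_Nil_iff)
next
  case (Cons e q)
  obtain y where e: "e = (x, y)" "(x, y) \<in> parcs G" "awalk y q r"
    using Cons.prems(1) by (cases e) (auto simp: awalk_Cons_iff)
  show ?case
  proof (cases "v = x")
    case False
    have "v \<in> path_verts G y s"
      using child_or_parent[OF assms(1) e(2)]
    proof
      assume "y \<in> children G s x"
      then show ?thesis
        using Cons.prems(2) by (simp add: path_verts_insert_child[OF assms(1)])
    next
      assume "x \<in> children G s y"
      then show ?thesis
        using Cons.prems(2) False by (simp add: path_verts_insert_child[OF assms(1)])
    qed
    then show ?thesis using Cons.IH[OF e(3)] e(1) by simp
  qed (use e in simp)
qed

lemma path_verts_diff_subset_reroot:
  assumes "s \<in> pverts G" "r \<in> pverts G" "x \<in> pverts G"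
  shows "path_verts G x s - path_verts G r s \<subseteq> path_verts G x r"
  using walk_leaving_subtree[OF assms(1)] finite_tree_apath_tree_path[OF tree assms(3,2)]
  by (auto simp: apath_def path_verts_def)

text \<open>
  A child of \<open>v\<close> with respect to \<open>s\<close> has to pass \<open>v\<close> in order to leave the subtree below \<open>v\<close>, which
  does not contain \<open>r\<close>; so it remains a child. There cannot be new children: for either root, all
  neighbours of \<open>v\<close> but one are children.
\<close>
lemma children_reroot:
  assumes "s \<in> pverts G" "r \<in> pverts G" "v \<in> pverts G" "v \<notin> path_verts G r s"
  shows "children G r v = children G s v"
proof -
  have "v \<noteq> s" "v \<noteq> r"
    using assms root_in_path_verts self_in_path_verts by auto
  then obtain u u' where u: "v \<in> children G s u" and u': "v \<in> children G r u'"
    using parent_exists assms by metis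
  have sub: "children G s v \<subseteq> children G r v"
  proof
    fix z assume z: "z \<in> children G s v"
    then have "v \<in> path_verts G z s" by (simp add: children_def)
    then have "v \<in> path_verts G z r"
      using path_verts_diff_subset_reroot[OF assms(1,2) children_verts(2)[OF z]] assms(4) by blast
    then show "z \<in> children G r v"
      using z by (simp add: children_def)
  qed
  have nbh: "insert u (children G s v) = insert u' (children G r v)"
    using neighbours_nonroot(1)[OF assms(1) u] neighbours_nonroot(1)[OF assms(2) u'] by simp
  have notin: "u \<notin> children G s v" "u' \<notin> children G r v"
    using neighbours_nonroot(2) u u' assms by auto
  have "u' = u" using nbh notin sub by blast
  then show ?thesis using nbh notin by (simp add: insert_ident)
qed

lemma weight_reroot:
  assumes "s \<in> pverts G" "r \<in> pverts G" "v \<in> pverts G" "v \<notin> path_verts G r s"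
  shows "weight p G r v = weight p G s v"
  using wf_children[OF tree assms(1)] assms(3,4)
proof (induction v rule: wf_induct_rule)
  case (less v)
  have "weight p G r z = weight p G s z" if z: "z \<in> children G s v" for z
  proof (rule less.IH)
    show "z \<in> pverts G" using children_verts[OF z] by simp
    have "v \<in> path_verts G z s" using z by (simp add: children_def)
    then show "z \<notin> path_verts G r s"
      using path_verts_subset[OF assms(1,2)] less.prems(2) by blast
  qed (use z in simp)
  then show ?case
    using children_reroot[OF assms(1,2) less.prems] weight_rec[OF tree assms(1), of p v]
      weight_rec[OF tree assms(2), of p v] by simp
qed

lemma weight_nonneg:
  assumes "r \<in> pverts G"
  shows "0 \<le> weight p G r v"
  using weight_rec[OF tree assms, of p v] by simp

lemma path_weight_le_tree_param_at:
  assumes "x \<in> pverts G"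
  shows "(\<Sum>v\<in>path_verts G x r - {r}. weight p G r v) \<le> tree_param_at p G r"
  unfolding tree_param_at_def using assms pair_finite_verts by (intro Max_ge) auto

text \<open>
  The vertices on the path from \<open>x\<close> to \<open>s\<close>, except \<open>s\<close>, are off the path from \<open>r\<close> to \<open>s\<close>. So they keep
  their weights when the root moves to \<open>r\<close>, and the path from \<open>x\<close> to \<open>r\<close> visits them as well.
\<close>
lemma path_weight_le_tree_param_at_reroot:
  assumes "s \<in> pverts G" "r \<in> pverts G" "x \<in> pverts G"
    and "path_verts G x s \<inter> path_verts G r s = {s}"
  shows "(\<Sum>v\<in>path_verts G x s - {s}. weight p G s v) \<le> tree_param_at p G r"
proof -
  have out: "v \<in> pverts G" "v \<notin> path_verts G r s" if "v \<in> path_verts G x s - {s}" for v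
    using that assms path_verts_in_verts by blast+
  have "(\<Sum>v\<in>path_verts G x s - {s}. weight p G s v) = (\<Sum>v\<in>path_verts G x s - {s}. weight p G r v)"
    using weight_reroot[OF assms(1,2) out] by simp
  also have "\<dots> \<le> (\<Sum>v\<in>path_verts G x r - {r}. weight p G r v)"
  proof (rule sum_mono2)
    show "path_verts G x s - {s} \<subseteq> path_verts G x r - {r}"
      using path_verts_diff_subset_reroot[OF assms(1-3)] out(2)
        self_in_path_verts[OF assms(2,1)] by blast
  qed (simp_all add: finite_path_verts weight_nonneg[OF assms(2)])
  also have "\<dots> \<le> tree_param_at p G r"
    using assms(3) by (rule path_weight_le_tree_param_at)
  finally show ?thesis .
qed

lemma path_meets_root_children:
  assumes "r \<in> pverts G" "x \<in> pverts G" "x \<noteq> r"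
  obtains c where "c \<in> children G r r" "c \<in> path_verts G x r"
proof -
  have "x = r \<or> (\<exists>c. c \<in> children G r r \<and> c \<in> path_verts G x r)"
    using assms(1,2)
  proof (induction rule: tree_induct)
    case (child v z)
    then show ?case
      using path_verts_insert_child[OF assms(1) child(2)] by auto
  qed simp
  then show ?thesis using assms(3) that by blast
qed

lemma tree_path_root_child:
  assumes "r \<in> pverts G" "c \<in> children G r r"
  shows "length (tree_path G c r) = 1"
  using tree_path_child[OF assms] tree_path_self[OF assms(1)] by simp

text \<open>
  A common vertex other than the root would lie below some child of the root. That child would be on
  both paths, and \<open>c\<close> is the only child of the root on the path from \<open>x\<close>.
\<close>
lemma branches_meet_in_root:
  assumes "r \<in> pverts G" "x \<in> pverts G" "y \<in> pverts G"
    and "c \<in> children G r r" "c \<in> path_verts G x r" "c \<notin> path_verts G y r"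
  shows "path_verts G x r \<inter> path_verts G y r = {r}"
proof -
  have "v = r" if v: "v \<in> path_verts G x r" "v \<in> path_verts G y r" for v
  proof (rule ccontr)
    assume "v \<noteq> r"
    then obtain b where b: "b \<in> children G r r" "b \<in> path_verts G v r"
      using path_meets_root_children[OF assms(1)] v path_verts_in_verts[OF assms(1,2)] by blast
    have "b = c"
      using path_vertex_unique_at_depth[OF assms(1,2) _ assms(5)] b
        path_verts_subset[OF assms(1,2) v(1)] tree_path_root_child[OF assms(1)] assms(4) by auto
    then show False
      using b path_verts_subset[OF assms(1,3) v(2)] assms(6) by blast
  qed
  then show ?thesis
    using root_in_path_verts assms by blast
qed

lemma root_child_avoiding_path:
  assumes "r \<in> pverts G" "y \<in> pverts G" "2 \<le> card (children G r r)"
  obtains c where "c \<in> children G r r" "c \<notin> path_verts G y r"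
proof -
  obtain a b where ab: "a \<in> children G r r" "b \<in> children G r r" "a \<noteq> b"
    using assms(3) card_le_Suc0_iff_eq[OF finite_children[of r r]] by fastforce
  then have "\<not> (a \<in> path_verts G y r \<and> b \<in> path_verts G y r)"
    using path_vertex_unique_at_depth[OF assms(1,2)] tree_path_root_child[OF assms(1)] by metis
  then show ?thesis using ab that by blast
qed

end

section \<open>Spherically symmetric trees\<close>

text \<open>
  The weight of a vertex in layer \<open>i\<close>, with \<open>q = 1 / (p - 1)\<close>, as the solution of the recursion in
  \<open>layer_weight_step\<close>. The last summand repeats the term \<open>j = k - 1\<close> of the sum, because the recursion
  starts from the value \<open>1\<close> at the leaves; for \<open>i = k\<close> it is the empty product.
\<close>
definition layer_weight :: "real \<Rightarrow> nat \<Rightarrow> (nat \<Rightarrow> nat) \<Rightarrow> nat \<Rightarrow> real" where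
  "layer_weight q k d i =
     (\<Sum>j=i..<k. (\<Prod>l=i..j. real (d l)) powr q) + (\<Prod>l=i..<k. real (d l)) powr q"

lemma layer_weight_leaf: "layer_weight q k d k = 1"
  by (simp add: layer_weight_def)

lemma layer_weight_step:
  assumes "i < k"
  shows "layer_weight q k d i = real (d i) powr q * (layer_weight q k d (Suc i) + 1)"
proof -
  have "(\<Sum>j=i..<k. (\<Prod>l=i..j. real (d l)) powr q)
      = real (d i) powr q + (\<Sum>j=Suc i..<k. (\<Prod>l=i..j. real (d l)) powr q)"
    using assms by (simp add: sum.atLeast_Suc_lessThan)
  also have "(\<Sum>j=Suc i..<k. (\<Prod>l=i..j. real (d l)) powr q)
      = real (d i) powr q * (\<Sum>j=Suc i..<k. (\<Prod>l=Suc i..j. real (d l)) powr q)"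
    unfolding sum_distrib_left
  proof (rule sum.cong)
    fix j assume "j \<in> {Suc i..<k}"
    then have "{i..j} = insert i {Suc i..j}" by auto
    then show "(\<Prod>l=i..j. real (d l)) powr q
        = real (d i) powr q * (\<Prod>l=Suc i..j. real (d l)) powr q"
      by (simp add: powr_mult prod_nonneg)
  qed simp
  finally have "(\<Sum>j=i..<k. (\<Prod>l=i..j. real (d l)) powr q)
      = real (d i) powr q * ((\<Sum>j=Suc i..<k. (\<Prod>l=Suc i..j. real (d l)) powr q) + 1)"
    by (simp add: distrib_left)
  moreover have "(\<Prod>l=i..<k. real (d l)) powr q
      = real (d i) powr q * (\<Prod>l=Suc i..<k. real (d l)) powr q"
    unfolding prod.atLeast_Suc_lessThan[OF assms] by (simp add: powr_mult prod_nonneg)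
  ultimately show ?thesis
    by (simp add: layer_weight_def distrib_left)
qed

lemma layer_weight_nonneg: "0 \<le> layer_weight q k d i"
  by (simp add: layer_weight_def sum_nonneg)

text \<open>
  Summing the formula for the weights gives \<open>1\<close> from the leaf, the double sum \<open>S\<close>, and a second copy of
  the terms with \<open>j = k - 1\<close>. These are nonnegative and occur among the terms of \<open>S\<close>.
\<close>
lemma sum_layer_weight_bounds:
  fixes S q :: real and d :: "nat \<Rightarrow> nat"
  assumes "1 \<le> k"
    and S_def: "S = (\<Sum>i=1..k-1. \<Sum>j=i..k-1. (\<Prod>l=i..j. real (d l)) powr q)"
  shows "1 + S \<le> (\<Sum>i=1..k. layer_weight q k d i)" "(\<Sum>i=1..k. layer_weight q k d i) \<le> 1 + 2 * S"
proof -
  define R where "R = (\<Sum>i=1..<k. (\<Prod>l=i..<k. real (d l)) powr q)"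
  have less: "{i..k-1} = {i..<k}" for i
    using assms(1) by auto
  have "{1..k} = insert k {1..<k}"
    using assms(1) by auto
  then have "(\<Sum>i=1..k. layer_weight q k d i) = 1 + (\<Sum>i=1..<k. layer_weight q k d i)"
    by (simp add: layer_weight_leaf)
  also have "(\<Sum>i=1..<k. layer_weight q k d i) = S + R"
    unfolding S_def R_def less layer_weight_def by (rule sum.distrib)
  finally have eq: "(\<Sum>i=1..k. layer_weight q k d i) = 1 + S + R"
    by simp
  have "R \<le> S"
    unfolding R_def S_def less
  proof (rule sum_mono)
    fix i assume i: "i \<in> {1..<k}"
    have "(\<Prod>l=i..<k. real (d l)) powr q = (\<Prod>l=i..k-1. real (d l)) powr q"
      by (simp only: less)
    also have "\<dots> \<le> (\<Sum>j=i..<k. (\<Prod>l=i..j. real (d l)) powr q)"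
    proof (rule member_le_sum)
      show "k - 1 \<in> {i..<k}" using i by auto
    qed simp_all
    finally show "(\<Prod>l=i..<k. real (d l)) powr q \<le> (\<Sum>j=i..<k. (\<Prod>l=i..j. real (d l)) powr q)" .
  qed
  moreover have "0 \<le> R"
    by (simp add: R_def sum_nonneg)
  ultimately show "1 + S \<le> (\<Sum>i=1..k. layer_weight q k d i)"
    "(\<Sum>i=1..k. layer_weight q k d i) \<le> 1 + 2 * S"
    using eq by simp_all
qed

locale spherical_tree = finite_tree_graph G for G :: "'a pair_pre_digraph" +
  fixes root :: 'a and k :: nat and d :: "nat \<Rightarrow> nat"
  assumes root: "root \<in> pverts G"
    and layers: "pverts G = (\<Union>i\<in>{0..k}. layer G root i)"
    and card_children: "\<lbrakk>i < k; v \<in> layer G root i\<rbrakk> \<Longrightarrow> card (children G root v) = d i"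
    and d_pos: "i < k \<Longrightarrow> 1 \<le> d i"
begin

lemma root_layer: "root \<in> layer G root 0"
  using root by (simp add: layer_def tree_path_self)

lemma layer_0: "layer G root 0 = {root}"
proof -
  have "v = root" if "v \<in> layer G root 0" for v
    using that finite_tree_apath_tree_path[OF tree _ root, of v]
    by (simp add: layer_def apath_Nil_iff)
  then show ?thesis using root_layer by blast
qed

lemma child_layer:
  assumes "v \<in> layer G root i" "z \<in> children G root v"
  shows "z \<in> layer G root (Suc i)"
  using assms children_verts[OF assms(2)] tree_path_child[OF root assms(2)]
  by (simp add: layer_def)

lemma vertex_layer:
  assumes "v \<in> pverts G"
  obtains i where "i \<le> k" "v \<in> layer G root i"
  using assms layers by auto

lemma layer_le: "v \<in> layer G root i \<Longrightarrow> i \<le> k"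
  using vertex_layer[of v] by (auto simp: layer_def)

lemma children_last_layer:
  assumes "v \<in> layer G root k"
  shows "children G root v = {}"
  using child_layer[OF assms] layer_le by fastforce

lemma leaf_below:
  assumes "v \<in> layer G root i"
  obtains x where "x \<in> layer G root k" "v \<in> path_verts G x root"
proof -
  have "i \<le> k" using assms by (rule layer_le)
  then have "\<exists>x. x \<in> layer G root k \<and> v \<in> path_verts G x root"
    using assms
  proof (induction arbitrary: v rule: inc_induct)
    case base
    then show ?case
      using self_in_path_verts[OF _ root] by (auto simp: layer_def)
  next
    case (step i)
    have "card (children G root v) \<noteq> 0"
      using card_children[OF step(2,4)] d_pos[OF step(2)] by simp
    then obtain z where z: "z \<in> children G root v"
      by fastforce
    then obtain x where x: "x \<in> layer G root k" "z \<in> path_verts G x root"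
      using step(3)[OF child_layer[OF step(4) z]] by blast
    have "v \<in> path_verts G z root"
      using z by (simp add: children_def)
    then show ?case
      using x path_verts_subset[OF root _ x(2)] by (auto simp: layer_def)
  qed
  then show ?thesis using that by blast
qed

lemma layer_nonempty:
  assumes "i \<le> k"
  shows "layer G root i \<noteq> {}"
  using assms
proof (induction i)
  case 0
  then show ?case using root_layer by blast
next
  case (Suc i)
  then obtain v where v: "v \<in> layer G root i" by fastforce
  have "card (children G root v) \<noteq> 0"
    using card_children[OF _ v] d_pos[of i] Suc.prems by simp
  then obtain z where "z \<in> children G root v" by fastforce
  then show ?case using child_layer[OF v] by blast
qed

lemma weight_layer:
  assumes "1 < p" "v \<in> layer G root i"
  shows "weight p G root v = layer_weight (1 / (p - 1)) k d i"
proof -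
  have "i \<le> k" using assms(2) by (rule layer_le)
  then show ?thesis
    using assms(2)
  proof (induction arbitrary: v rule: inc_induct)
    case base
    then show ?case
      using weight_rec[OF tree root, of p v] by (simp add: children_last_layer layer_weight_leaf)
  next
    case (step i)
    let ?w = "layer_weight (1 / (p - 1)) k d"
    have card: "card (children G root v) = d i"
      using card_children[OF step(2,4)] .
    then have "children G root v \<noteq> {}"
      using d_pos[OF step(2)] by auto
    then have "weight p G root v = (real (d i) * (?w (Suc i) + 1) powr (p - 1)) powr (1 / (p - 1))"
      using weight_rec[OF tree root, of p v] step(3)[OF child_layer[OF step(4)]] card by simp
    also have "\<dots> = real (d i) powr (1 / (p - 1)) * (?w (Suc i) + 1)"
      using assms(1) layer_weight_nonneg[of "1 / (p - 1)" k d "Suc i"]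
      by (simp add: powr_mult powr_powr)
    finally show ?case using layer_weight_step[OF step(2)] by simp
  qed
qed

lemma path_weight_layer:
  assumes "1 < p" "x \<in> layer G root i"
  shows "(\<Sum>v\<in>path_verts G x root - {root}. weight p G root v)
    = (\<Sum>j=1..i. layer_weight (1 / (p - 1)) k d j)"
proof -
  have "x \<in> pverts G" using assms(2) by (simp add: layer_def)
  with root show ?thesis
    using assms(2)
  proof (induction arbitrary: i rule: tree_induct)
    case root
    then have "i = 0" using root_layer by (simp add: layer_def)
    then show ?case using \<open>root \<in> pverts G\<close> by (simp add: path_verts_self)
  next
    case (child v z)
    obtain j where j: "v \<in> layer G root j" using vertex_layer[OF child(1)] by blast
    have i: "i = Suc j"
      using child_layer[OF j child(2)] child(4) by (simp add: layer_def)
    have "z \<noteq> root" using root_not_child[OF root] child(2) by blast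
    then have "path_verts G z root - {root} = insert z (path_verts G v root - {root})"
      by (auto simp: path_verts_insert_child[OF root child(2)])
    then show ?case
      using child_not_in_path_verts[OF root child(2)] child(3)[OF j] weight_layer[OF assms(1) child(4)]
      by (simp add: finite_path_verts i)
  qed
qed

lemma tree_param_at_root:
  assumes "1 < p"
  shows "tree_param_at p G root = (\<Sum>j=1..k. layer_weight (1 / (p - 1)) k d j)"
  unfolding tree_param_at_def
proof (rule Max_eqI)
  fix y assume "y \<in> (\<lambda>x. \<Sum>v\<in>path_verts G x root - {root}. weight p G root v) ` pverts G"
  then obtain x i where "i \<le> k" "y = (\<Sum>j=1..i. layer_weight (1 / (p - 1)) k d j)"
    using path_weight_layer[OF assms] vertex_layer by (metis (no_types, lifting) imageE)
  then show "y \<le> (\<Sum>j=1..k. layer_weight (1 / (p - 1)) k d j)"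
    by (auto intro!: sum_mono2 layer_weight_nonneg)
next
  obtain x where x: "x \<in> layer G root k" using layer_nonempty by blast
  then show "(\<Sum>j=1..k. layer_weight (1 / (p - 1)) k d j)
      \<in> (\<lambda>x. \<Sum>v\<in>path_verts G x root - {root}. weight p G root v) ` pverts G"
    using path_weight_layer[OF assms x] by (intro image_eqI[of _ _ x]) (auto simp: layer_def)
qed (use pair_finite_verts in simp)

text \<open>
  Compare along the path from a leaf \<open>x\<close> below a child \<open>c\<close> of the root that the path from \<open>r\<close> avoids:
  that path attains the maximum for the root, and it loses nothing when the root moves to \<open>r\<close>.
\<close>
lemma tree_param_at_root_le:
  assumes "1 < p" "1 \<le> k" "2 \<le> d 0" "r \<in> pverts G"
  shows "tree_param_at p G root \<le> tree_param_at p G r"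
proof -
  have "2 \<le> card (children G root root)"
    using card_children[OF _ root_layer] assms(2,3) by simp
  then obtain c where c: "c \<in> children G root root" "c \<notin> path_verts G r root"
    using root_child_avoiding_path[OF root assms(4)] by blast
  obtain x where x: "x \<in> layer G root k" "c \<in> path_verts G x root"
    using leaf_below[OF child_layer[OF root_layer c(1)]] by blast
  then have "x \<in> pverts G" by (simp add: layer_def)
  then have "(\<Sum>v\<in>path_verts G x root - {root}. weight p G root v) \<le> tree_param_at p G r"
    using branches_meet_in_root[OF root _ assms(4) c(1) x(2) c(2)] root assms(4)
    by (intro path_weight_le_tree_param_at_reroot) auto
  then show ?thesis
    using tree_param_at_root[OF assms(1)] path_weight_layer[OF assms(1) x(1)] by simp
qed

lemma out_degree_layer:
  assumes "v \<in> layer G root i"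
  shows "out_degree (with_proj G) v = (if i = 0 then 0 else 1) + (if i < k then d i else 0)"
proof -
  have card: "card (children G root v) = (if i < k then d i else 0)"
    using card_children[OF _ assms] children_last_layer layer_le[OF assms] assms
    by (cases "i = k") auto
  show ?thesis
  proof (cases "i = 0")
    case True
    then have "v = root" using assms layer_0 by simp
    then show ?thesis
      using card True by (simp add: out_degree_neighbours neighbours_root[OF root])
  next
    case False
    then have "v \<noteq> root" "v \<in> pverts G"
      using assms root_layer by (auto simp: layer_def)
    then obtain u where u: "v \<in> children G root u"
      using parent_exists[OF root] by blast
    show ?thesis
      using card False neighbours_nonroot[OF root u]
      by (simp add: out_degree_neighbours finite_children)
  qed
qed

text \<open>
  The leaves have degree \<open>1\<close>, which is below \<open>d 0\<close>; all other values are attained since no layer is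
  empty.
\<close>
lemma max_degree_eq:
  assumes "1 \<le> k" "2 \<le> d 0"
  shows "max_degree G = (if k = 1 then d 0 else max (d 0) (1 + Max (d ` {1..<k})))"
  unfolding max_degree_def
proof (rule Max_eqI)
  fix y assume "y \<in> out_degree (with_proj G) ` pverts G"
  then obtain v i where i: "i \<le> k" "v \<in> layer G root i" and y: "y = out_degree (with_proj G) v"
    using vertex_layer by (metis imageE)
  have "d i \<le> Max (d ` {1..<k})" if "0 < i" "i < k"
    using that by (intro Max_ge) auto
  with assms i show "y \<le> (if k = 1 then d 0 else max (d 0) (1 + Max (d ` {1..<k})))"
    by (auto simp: y out_degree_layer[OF i(2)] le_max_iff_disj)
next
  have deg: "d 0 \<in> out_degree (with_proj G) ` pverts G"
    using out_degree_layer[OF root_layer] assms(1) root by (intro image_eqI[of _ _ root]) auto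
  have "1 + Max (d ` {1..<k}) \<in> out_degree (with_proj G) ` pverts G" if "k \<noteq> 1"
  proof -
    have "Max (d ` {1..<k}) \<in> d ` {1..<k}"
      using that assms(1) by (intro Max_in) auto
    then obtain i where i: "1 \<le> i" "i < k" "Max (d ` {1..<k}) = d i" by auto
    then obtain v where v: "v \<in> layer G root i" using layer_nonempty[of i] by fastforce
    then show ?thesis
      using out_degree_layer[OF v] i by (intro image_eqI[of _ _ v]) (auto simp: layer_def)
  qed
  with deg show "(if k = 1 then d 0 else max (d 0) (1 + Max (d ` {1..<k})))
      \<in> out_degree (with_proj G) ` pverts G"
    by (auto simp: max_def)
qed (use pair_finite_verts in simp)

end

theorem proposition7p8:
  fixes p S :: real and k :: nat and d :: "nat \<Rightarrow> nat"
    and G :: "'a pair_pre_digraph" and root :: 'a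
  assumes "1 < p"
    and "1 \<le> k"
    and "\<forall>i<k. 1 \<le> d i"
    and "2 \<le> d 0"
    and "spherically_symmetric_tree G root k d"
    and "S = (\<Sum>i=1..k-1. \<Sum>j=i..k-1. (\<Prod>l=i..j. real (d l)) powr (1 / (p - 1)))"
  shows "is_arg_min (tree_param_at p G) (\<lambda>r. r \<in> pverts G) root \<and>
    1 + S \<le> tree_param p G \<and> tree_param p G \<le> 1 + 2 * S \<and>
    max_degree G = (if k = 1 then d 0 else max (d 0) (1 + Max (d ` {1..<k})))"
proof -
  have ft: "finite_tree G"
    using assms(5) by (simp add: spherically_symmetric_tree_def)
  interpret pair_graph G
    using ft by (simp add: finite_tree_def)
  interpret spherical_tree G root k d
    using assms(3,5) ft by unfold_locales (auto simp: spherically_symmetric_tree_def)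
  have le: "tree_param_at p G root \<le> tree_param_at p G r" if "r \<in> pverts G" for r
    using tree_param_at_root_le[OF assms(1,2,4) that] .
  have "tree_param p G = tree_param_at p G root"
    unfolding tree_param_def using le root pair_finite_verts by (intro Min_eqI) auto
  then have "1 + S \<le> tree_param p G" "tree_param p G \<le> 1 + 2 * S"
    using sum_layer_weight_bounds[OF assms(2,6)] tree_param_at_root[OF assms(1)]
    by simp_all
  moreover have "is_arg_min (tree_param_at p G) (\<lambda>r. r \<in> pverts G) root"
    using le root by (auto simp: is_arg_min_def not_less)
  ultimately show ?thesis
    using max_degree_eq[OF assms(2,4)] by simp
qed

end
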